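(* Let $\lambda>0$ and let $G$ be a $\lambda$-precision unit disk graph. Then $$\frac{\mathrm{FCC}(G)}{\mathrm{Ind}(G)}\le\frac{64}{\lambda^2}+1,$$ and furthermore an approximation of $\mathrm{Ind}(G)$ with approximation factor $\frac{64}{\lambda^2}+1$ can be obtained in time polynomial in the size of $G$.
   Context: A unit disk graph is a finite simple undirected graph (with at least one vertex) for which one can assign to each vertex a closed disk of radius $1$ in the plane such that two distinct vertices are adjacent if and only if their disks intersect (overlapping or touching at a single point); such an assignment is a geometric representation. For $\lambda>0$, a $\lambda$-precision unit disk graph is a unit disk graph having a geometric representation by unit disks in which the centers of every two distinct disks are at distance at least $\lambda$. Let $G$ have vertices $v_1,\dots,v_n$; $N(v_i)$ is the set of neighbors of $v_i$ (not containing $v_i$). Index coding rate: for a finite alphabet $\Sigma$ with $|\Sigma|=q\ge 2$, an index code for $G$ consists of a finite set $M$, an encoding function $f:\Sigma^n\to M$, and decoding functions $g_i:M\times\Sigma^{|N(v_i)|}\to\Sigma$ ($i=1,\dots,n$) such that $g_i(f(p),(p_j)_{v_j\in N(v_i)})=p_i$ for all $p=(p_1,\dots,p_n)\in\Sigma^n$ and all $i$. Its rate is $\log_q|M|$. $\mathrm{Ind}_q(G)$ is the minimum rate over all such codes with alphabet size $q$, and $\mathrm{Ind}(G)=\inf_{q\ge2}\mathrm{Ind}_q(G)$. An approximation of $\mathrm{Ind}(G)$ with factor $c$ means an index coding solution for $G$ whose rate $A$ satisfies $\mathrm{Ind}(G)\le A\le c\cdot\mathrm{Ind}(G)$. Minimum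 fractional clique cover: let $\mathcal K$ be the set of all cliques (nonempty vertex sets inducing complete subgraphs, including single vertices) of $G$. $\mathrm{FCC}(G)$ is the minimum of $\sum_{C\in\mathcal K}y_C$ subject to $\sum_{C\in\mathcal K:v\in C}y_C\ge1$ for all vertices $v$ and $0\le y_C\le1$ for all $C\in\mathcal K$. *)

theory Defs
  imports "HOL-Analysis.Analysis" "HOL-Library.Ramsey"
begin

section \<open>Graphs and unit disk graphs\<close>

definition simple_graph :: "'v set \<Rightarrow> 'v set set \<Rightarrow> bool" where
  "simple_graph V E \<longleftrightarrow> finite V \<and> V \<noteq> {} \<and> E \<subseteq> [V]\<^bsup>2\<^esup>"

definition nbrs :: "'v set set \<Rightarrow> 'v \<Rightarrow> 'v set" where
  "nbrs E v = {u. u \<noteq> v \<and> {u, v} \<in> E}"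

definition disk_representation :: "'v set \<Rightarrow> 'v set set \<Rightarrow> ('v \<Rightarrow> real^2) \<Rightarrow> bool" where
  "disk_representation V E c \<longleftrightarrow>
     (\<forall>u\<in>V. \<forall>v\<in>V. u \<noteq> v \<longrightarrow> ({u, v} \<in> E \<longleftrightarrow> cball (c u) 1 \<inter> cball (c v) 1 \<noteq> {}))"

definition unit_disk_graph :: "'v set \<Rightarrow> 'v set set \<Rightarrow> bool" where
  "unit_disk_graph V E \<longleftrightarrow> simple_graph V E \<and> (\<exists>c. disk_representation V E c)"

definition precision_unit_disk_graph :: "real \<Rightarrow> 'v set \<Rightarrow> 'v set set \<Rightarrow> bool" where
  "precision_unit_disk_graph l V E \<longleftrightarrow> unit_disk_graph V E \<and>
     (\<exists>c. disk_representation V E c \<and> (\<forall>u\<in>V. \<forall>v\<in>V. u \<noteq> v \<longrightarrow> l \<le> dist (c u) (c v)))"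


section \<open>Index coding rate\<close>

text \<open>A tuple of symbols indexed by a set of vertices is an extensional function; the side
  information of a vertex is the restriction of such a tuple to its neighbours.\<close>

definition index_code ::
  "'v set \<Rightarrow> 'v set set \<Rightarrow> 's set \<Rightarrow> 'm set \<Rightarrow> (('v \<Rightarrow> 's) \<Rightarrow> 'm) \<Rightarrow> ('v \<Rightarrow> 'm \<Rightarrow> ('v \<Rightarrow> 's) \<Rightarrow> 's) \<Rightarrow> bool"
where
  "index_code V E \<Sigma> M f g \<longleftrightarrow>
     finite \<Sigma> \<and> 2 \<le> card \<Sigma> \<and> finite M \<and>
     f \<in> (V \<rightarrow>\<^sub>E \<Sigma>) \<rightarrow> M \<and>
     (\<forall>v\<in>V. \<forall>m\<in>M. g v m \<in> (nbrs E v \<rightarrow>\<^sub>E \<Sigma>) \<rightarrow> \<Sigma>) \<and>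
     (\<forall>p\<in>V \<rightarrow>\<^sub>E \<Sigma>. \<forall>v\<in>V. g v (f p) (restrict p (nbrs E v)) = p v)"

definition code_rate :: "'s set \<Rightarrow> 'm set \<Rightarrow> real" where
  "code_rate \<Sigma> M = log (real (card \<Sigma>)) (real (card M))"

text \<open>Only the cardinalities of the alphabet and of the message set matter, so both range over
  sets of natural numbers. The infimum over the codes of a fixed alphabet size is attained,
  since the rate is determined by the natural number \<^term>\<open>card M\<close>.\<close>

definition Ind_q :: "nat \<Rightarrow> 'v set \<Rightarrow> 'v set set \<Rightarrow> real" where
  "Ind_q q V E = Inf {code_rate \<Sigma> M | (\<Sigma> :: nat set) (M :: nat set).
     card \<Sigma> = q \<and> (\<exists>f g. index_code V E \<Sigma> M f g)}"

definition Ind :: "'v set \<Rightarrow> 'v set set \<Rightarrow> real" where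
  "Ind V E = (INF q\<in>{2..}. Ind_q q V E)"


section \<open>Fractional clique cover\<close>

definition cliques :: "'v set \<Rightarrow> 'v set set \<Rightarrow> 'v set set" where
  "cliques V E = {C. C \<subseteq> V \<and> C \<noteq> {} \<and> clique C E}"

definition fractional_clique_cover :: "'v set \<Rightarrow> 'v set set \<Rightarrow> ('v set \<Rightarrow> real) \<Rightarrow> bool" where
  "fractional_clique_cover V E y \<longleftrightarrow>
     (\<forall>v\<in>V. (\<Sum>C\<in>{C \<in> cliques V E. v \<in> C}. y C) \<ge> 1) \<and>
     (\<forall>C\<in>cliques V E. 0 \<le> y C \<and> y C \<le> 1)"

text \<open>The infimum of this linear program is a minimum: it is feasible and its feasible region
  is compact.\<close>

definition FCC :: "'v set \<Rightarrow> 'v set set \<Rightarrow> real" where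
  "FCC V E = Inf {\<Sum>C\<in>cliques V E. y C | y. fractional_clique_cover V E y}"


section \<open>Deterministic multi-tape Turing machines\<close>

text \<open>All tapes are two-way infinite. Tape 0 carries the input and tape 1 the output. The
  machine starts in state 0 and halts in state \<open>nstates\<close>.\<close>

datatype sym = Blank | Bit bool

datatype move = MoveL | Stay | MoveR

type_synonym tape = "(int \<Rightarrow> sym) \<times> int"

record tm =
  ntapes :: nat
  nstates :: nat
  delta :: "nat \<Rightarrow> sym list \<Rightarrow> nat \<times> (sym \<times> move) list"

definition wf_tm :: "tm \<Rightarrow> bool" where
  "wf_tm T \<longleftrightarrow> 2 \<le> ntapes T \<and>
     (\<forall>q<nstates T. \<forall>ss. length ss = ntapes T \<longrightarrow>
        fst (delta T q ss) \<le> nstates T \<and> length (snd (delta T q ss)) = ntapes T)"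

fun read_tape :: "tape \<Rightarrow> sym" where
  "read_tape (c, h) = c h"

fun shift :: "move \<Rightarrow> int" where
  "shift MoveL = -1"
| "shift Stay = 0"
| "shift MoveR = 1"

fun act_tape :: "sym \<times> move \<Rightarrow> tape \<Rightarrow> tape" where
  "act_tape (s, d) (c, h) = (c(h := s), h + shift d)"

fun tm_step :: "tm \<Rightarrow> nat \<times> tape list \<Rightarrow> nat \<times> tape list" where
  "tm_step T (q, ts) =
     (if q < nstates T
      then (case delta T q (map read_tape ts) of (q', as) \<Rightarrow> (q', map2 act_tape as ts))
      else (q, ts))"

definition word_on_tape :: "bool list \<Rightarrow> int \<Rightarrow> sym" where
  "word_on_tape w i = (if 0 \<le> i \<and> nat i < length w then Bit (w ! nat i) else Blank)"

definition tm_init :: "tm \<Rightarrow> bool list \<Rightarrow> nat \<times> tape list" where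
  "tm_init T x = (0, (word_on_tape x, 0) # replicate (ntapes T - 1) (word_on_tape [], 0))"

definition tm_outputs :: "tm \<Rightarrow> bool list \<Rightarrow> bool list \<Rightarrow> nat \<Rightarrow> bool" where
  "tm_outputs T x y t \<longleftrightarrow>
     (case (tm_step T ^^ t) (tm_init T x) of (q, ts) \<Rightarrow>
        q = nstates T \<and> fst (ts ! 1) = word_on_tape y)"


section \<open>Index codes described by Boolean circuits\<close>

text \<open>The function tables of an index code have size exponential in the number of vertices, so
  an algorithm outputs the encoder and the decoders as circuits. A circuit is a list of NAND
  gates together with a list of output wires; wires are numbered consecutively, the inputs
  first and then the gates in order.\<close>

type_synonym circuit = "(nat \<times> nat) list \<times> nat list"

fun eval_gates :: "(nat \<times> nat) list \<Rightarrow> bool list \<Rightarrow> bool list" where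
  "eval_gates [] ws = ws"
| "eval_gates ((a, b) # gs) ws = eval_gates gs (ws @ [\<not> (ws ! a \<and> ws ! b)])"

fun eval_circuit :: "circuit \<Rightarrow> bool list \<Rightarrow> bool list" where
  "eval_circuit (gs, os) x = map (\<lambda>j. eval_gates gs x ! j) os"

fun wf_circuit :: "nat \<Rightarrow> nat \<Rightarrow> circuit \<Rightarrow> bool" where
  "wf_circuit n_in n_out (gs, os) \<longleftrightarrow>
     (\<forall>i<length gs. fst (gs ! i) < n_in + i \<and> snd (gs ! i) < n_in + i) \<and>
     (\<forall>j\<in>set os. j < n_in + length gs) \<and> length os = n_out"

text \<open>Symbols are the bit strings of length \<open>sym_width\<close>; messages are the bit strings whose
  length is the number of outputs of the encoder.\<close>

record code_desc =
  sym_width :: nat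
  encoder :: circuit
  decoders :: "circuit list"

definition bit_words :: "nat \<Rightarrow> bool list set" where
  "bit_words k = {w. length w = k}"

definition msg_width :: "code_desc \<Rightarrow> nat" where
  "msg_width d = length (snd (encoder d))"

definition desc_encode :: "nat \<Rightarrow> code_desc \<Rightarrow> (nat \<Rightarrow> bool list) \<Rightarrow> bool list" where
  "desc_encode n d p = eval_circuit (encoder d) (concat (map p [0..<n]))"

text \<open>A decoder reads the message followed by the symbols of the neighbours in increasing
  order.\<close>

definition desc_decode ::
  "nat set set \<Rightarrow> code_desc \<Rightarrow> nat \<Rightarrow> bool list \<Rightarrow> (nat \<Rightarrow> bool list) \<Rightarrow> bool list" where
  "desc_decode E d v m s =
     eval_circuit (decoders d ! v) (m @ concat (map s (sorted_list_of_set (nbrs E v))))"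

definition describes_index_code :: "nat \<Rightarrow> nat set set \<Rightarrow> code_desc \<Rightarrow> bool" where
  "describes_index_code n E d \<longleftrightarrow>
     wf_circuit (n * sym_width d) (msg_width d) (encoder d) \<and>
     length (decoders d) = n \<and>
     (\<forall>v<n. wf_circuit (msg_width d + card (nbrs E v) * sym_width d) (sym_width d)
              (decoders d ! v)) \<and>
     index_code {..<n} E (bit_words (sym_width d)) (bit_words (msg_width d))
       (desc_encode n d) (desc_decode E d)"

definition desc_rate :: "code_desc \<Rightarrow> real" where
  "desc_rate d = code_rate (bit_words (sym_width d)) (bit_words (msg_width d))"


section \<open>Binary encodings\<close>

definition enc_nat :: "nat \<Rightarrow> bool list" where
  "enc_nat n = replicate n True @ [False]"

definition enc_list :: "('a \<Rightarrow> bool list) \<Rightarrow> 'a list \<Rightarrow> bool list" where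
  "enc_list e xs = enc_nat (length xs) @ concat (map e xs)"

fun enc_gate :: "nat \<times> nat \<Rightarrow> bool list" where
  "enc_gate (a, b) = enc_nat a @ enc_nat b"

fun enc_circuit :: "circuit \<Rightarrow> bool list" where
  "enc_circuit (gs, os) = enc_list enc_gate gs @ enc_list enc_nat os"

definition enc_desc :: "code_desc \<Rightarrow> bool list" where
  "enc_desc d =
     enc_nat (sym_width d) @ enc_circuit (encoder d) @ enc_list enc_circuit (decoders d)"

text \<open>The number of vertices in unary, followed by the rows of the adjacency matrix.\<close>

definition enc_graph :: "nat \<Rightarrow> nat set set \<Rightarrow> bool list" where
  "enc_graph n E = enc_nat n @ concat (map (\<lambda>i. map (\<lambda>j. {i, j} \<in> E) [0..<n]) [0..<n])"

text \<open>The output word determines the described code.\<close>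

lemma enc_nat_delim: "enc_nat a @ u = enc_nat b @ v \<longleftrightarrow> a = b \<and> u = v"
proof (induction a arbitrary: b)
  case 0
  then show ?case by (cases b) (auto simp: enc_nat_def)
next
  case (Suc a)
  then show ?case by (cases b) (auto simp: enc_nat_def)
qed

lemma enc_list_delim:
  assumes "\<And>a b u v. e a @ u = e b @ v \<longleftrightarrow> a = b \<and> u = v"
  shows "enc_list e xs @ u = enc_list e ys @ v \<longleftrightarrow> xs = ys \<and> u = v"
proof -
  have "length xs = length ys \<Longrightarrow>
      concat (map e xs) @ u = concat (map e ys) @ v \<longleftrightarrow> xs = ys \<and> u = v"
    by (induction xs ys rule: list_induct2) (auto simp: assms)
  then show ?thesis by (auto simp: enc_list_def enc_nat_delim)
qed

lemma enc_gate_delim: "enc_gate a @ u = enc_gate b @ v \<longleftrightarrow> a = b \<and> u = v"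
  by (cases a; cases b) (auto simp: enc_nat_delim)

lemma enc_circuit_delim: "enc_circuit a @ u = enc_circuit b @ v \<longleftrightarrow> a = b \<and> u = v"
  by (cases a; cases b)
    (auto simp: enc_list_delim[of enc_gate, OF enc_gate_delim]
       enc_list_delim[of enc_nat, OF enc_nat_delim])

lemma inj_enc_desc: "inj enc_desc"
proof (rule injI)
  fix c d assume "enc_desc c = enc_desc d"
  then have "enc_desc c @ [] = enc_desc d @ []" by simp
  then show "c = d"
    unfolding enc_desc_def append_assoc enc_nat_delim enc_circuit_delim
      enc_list_delim[of enc_circuit, OF enc_circuit_delim]
    by simp
qed


section \<open>Polynomial-time approximation\<close>

text \<open>A single machine handles all graphs of the class \<open>P\<close>, whose vertices are numbered
  \<open>0, \<dots>, n - 1\<close>. It is given the graph only, without a geometric representation.\<close>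

definition Ind_poly_time_approximable :: "(nat set \<Rightarrow> nat set set \<Rightarrow> bool) \<Rightarrow> real \<Rightarrow> bool" where
  "Ind_poly_time_approximable P c \<longleftrightarrow>
     (\<exists>(T :: tm) (b :: nat poly). wf_tm T \<and>
        (\<forall>n E. P {..<n} E \<longrightarrow>
           (\<exists>d t. t \<le> poly b (n + card E) \<and>
              tm_outputs T (enc_graph n E) (enc_desc d) t \<and>
              describes_index_code n E d \<and>
              Ind {..<n} E \<le> desc_rate d \<and> desc_rate d \<le> c * Ind {..<n} E)))"

end

theory Submission
  imports Defs
begin

text \<open>Disks of radius \<open>l / 2\<close> around the neighbours of a vertex are disjoint and lie in a disk of
  radius \<open>2 + l / 2\<close>, so closed neighbourhoods have at most \<open>(4 / l + 1)\<^sup>2\<close> vertices, which is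
  below \<open>c = 64 / l\<^sup>2 + 1\<close> as soon as \<open>l \<le> 2\<close>; for larger \<open>l\<close> there are no edges.
  A maximal independent set therefore has at least \<open>n / c\<close> elements. Its symbols are determined
  by the message alone once the other symbols are fixed, hence \<open>n / c \<le> Ind\<close>. As \<open>FCC \<le> n\<close>
  by the cover with single vertices, this bounds the ratio, and the code that broadcasts all \<open>n\<close>
  bits is already a \<open>c\<close>-approximation. Its description depends on \<open>n\<close> only and is printed by a
  Turing machine that counts in unary.\<close>

section \<open>Bounds on the index coding rate\<close>

lemma nbrs_subset:
  assumes "simple_graph V E"
  shows "nbrs E v \<subseteq> V"
  using assms by (auto simp: nbrs_def simple_graph_def nsets_def)

text \<open>Freeze all symbols outside \<open>S\<close> to one value \<open>a\<close>. A vertex of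
  \<open>S\<close> has no neighbour in \<open>S\<close>, so its side information is then constant
  and the message alone determines its symbol. Hence encoding is injective on the
  \<open>|Sigma|^|S|\<close> remaining tuples.\<close>

lemma independent_set_le_code_rate:
  assumes G: "simple_graph V E" and code: "index_code V E \<Sigma> M f g"
    and S: "S \<subseteq> V" "\<And>u v. u \<in> S \<Longrightarrow> v \<in> S \<Longrightarrow> u \<notin> nbrs E v"
  shows "real (card S) \<le> code_rate \<Sigma> M"
proof -
  have fin: "finite \<Sigma>" "finite M" and card2: "2 \<le> card \<Sigma>" and f: "f \<in> (V \<rightarrow>\<^sub>E \<Sigma>) \<rightarrow> M"
    and dec: "\<And>p v. p \<in> V \<rightarrow>\<^sub>E \<Sigma> \<Longrightarrow> v \<in> V \<Longrightarrow> g v (f p) (restrict p (nbrs E v)) = p v"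
    using code by (auto simp: index_code_def)
  have finS: "finite S"
    using G S(1) by (meson simple_graph_def finite_subset)
  obtain a where a: "a \<in> \<Sigma>"
    using card2 by (cases "\<Sigma> = {}") auto
  define h where "h p = restrict (\<lambda>v. if v \<in> S then p v else a) V" for p
  have h_in: "h p \<in> V \<rightarrow>\<^sub>E \<Sigma>" if "p \<in> S \<rightarrow>\<^sub>E \<Sigma>" for p
    using that a by (auto simp: h_def PiE_iff)
  have "inj_on (\<lambda>p. f (h p)) (S \<rightarrow>\<^sub>E \<Sigma>)"
  proof (rule inj_onI)
    fix p p' assume p: "p \<in> S \<rightarrow>\<^sub>E \<Sigma>" "p' \<in> S \<rightarrow>\<^sub>E \<Sigma>" and eq: "f (h p) = f (h p')"
    show "p = p'"
    proof (rule PiE_ext[OF p])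
      fix v assume v: "v \<in> S"
      have "restrict (h p) (nbrs E v) = restrict (h p') (nbrs E v)"
        using S(2) v by (auto simp: h_def restrict_def fun_eq_iff)
      then have "h p v = h p' v"
        using dec[OF h_in[OF p(1)], of v] dec[OF h_in[OF p(2)], of v] eq v S(1) by auto
      then show "p v = p' v"
        using v S(1) by (auto simp: h_def)
    qed
  qed
  moreover have "(\<lambda>p. f (h p)) ` (S \<rightarrow>\<^sub>E \<Sigma>) \<subseteq> M"
    using f h_in by auto
  ultimately have "card (S \<rightarrow>\<^sub>E \<Sigma>) \<le> card M"
    using fin(2) by (rule card_inj_on_le)
  then have "real (card \<Sigma>) ^ card S \<le> real (card M)"
    using finS by (simp add: card_PiE flip: of_nat_power)
  moreover have "0 < real (card \<Sigma>) ^ card S"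
    using card2 by (intro zero_less_power) linarith
  ultimately have "log (card \<Sigma>) (real (card \<Sigma>) ^ card S) \<le> log (card \<Sigma>) (card M)"
    using card2 by (intro log_mono) auto
  then show ?thesis
    using card2 by (simp add: code_rate_def log_nat_power)
qed

text \<open>Broadcasting the whole tuple, numbered by a bijection, always works. This makes the sets
  of rates nonempty, and for \<open>q = 2\<close> it bounds \<open>Ind\<close> from above.\<close>

lemma trivial_index_code:
  fixes q :: nat
  assumes "simple_graph V E" and q: "2 \<le> q"
  shows "\<exists>f g. index_code V E {..<q} {..<q ^ card V} f g"
proof -
  have fin: "finite V"
    using assms by (simp add: simple_graph_def)
  have "finite (V \<rightarrow>\<^sub>E {..<q})" "card (V \<rightarrow>\<^sub>E {..<q}) = q ^ card V"
    using fin by (simp_all add: card_PiE finite_PiE)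
  then obtain f where f: "bij_betw f (V \<rightarrow>\<^sub>E {..<q}) {..<q ^ card V}"
    using ex_bij_betw_finite_nat[of "V \<rightarrow>\<^sub>E {..<q}"] by (auto simp: atLeast0LessThan)
  define g :: "'a \<Rightarrow> nat \<Rightarrow> ('a \<Rightarrow> nat) \<Rightarrow> nat"
    where "g v m s = inv_into (V \<rightarrow>\<^sub>E {..<q}) f m v" for v m s
  have inv_in: "inv_into (V \<rightarrow>\<^sub>E {..<q}) f m \<in> V \<rightarrow>\<^sub>E {..<q}" if "m < q ^ card V" for m
    using f that by (metis bij_betw_imp_surj_on inv_into_into lessThan_iff)
  have "index_code V E {..<q} {..<q ^ card V} f g"
    unfolding index_code_def
  proof (intro conjI ballI)
    show "f \<in> (V \<rightarrow>\<^sub>E {..<q}) \<rightarrow> {..<q ^ card V}"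
      using f by (rule bij_betw_imp_funcset)
    show "g v m \<in> (nbrs E v \<rightarrow>\<^sub>E {..<q}) \<rightarrow> {..<q}" if "v \<in> V" "m \<in> {..<q ^ card V}" for v m
      using inv_in[of m] that by (auto simp: g_def PiE_iff)
    show "g v (f p) (restrict p (nbrs E v)) = p v" if "p \<in> V \<rightarrow>\<^sub>E {..<q}" for v p
      using f that by (simp add: g_def bij_betw_inv_into_left)
  qed (use q in auto)
  then show ?thesis by blast
qed

lemma code_rate_trivial:
  fixes q :: nat
  assumes "2 \<le> q"
  shows "code_rate {..<q} {..<q ^ n} = real n"
  using assms by (simp add: code_rate_def log_nat_power)

lemma independent_set_le_Ind_q:
  assumes G: "simple_graph V E" and q: "2 \<le> q"
    and S: "S \<subseteq> V" "\<And>u v. u \<in> S \<Longrightarrow> v \<in> S \<Longrightarrow> u \<notin> nbrs E v"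
  shows "real (card S) \<le> Ind_q q V E"
  unfolding Ind_q_def
proof (rule cInf_greatest)
  have "card {..<q} = q"
    by simp
  then show "{code_rate \<Sigma> M |(\<Sigma> :: nat set) (M :: nat set).
      card \<Sigma> = q \<and> (\<exists>f g. index_code V E \<Sigma> M f g)} \<noteq> {}"
    using trivial_index_code[OF G q] by blast
qed (use independent_set_le_code_rate[OF G _ S] in blast)

lemma independent_set_le_Ind:
  assumes "simple_graph V E"
    and "S \<subseteq> V" "\<And>u v. u \<in> S \<Longrightarrow> v \<in> S \<Longrightarrow> u \<notin> nbrs E v"
  shows "real (card S) \<le> Ind V E"
  unfolding Ind_def
  by (rule cINF_greatest) (use independent_set_le_Ind_q[OF assms(1) _ assms(2,3)] in auto)

lemma Ind_le_card:
  assumes G: "simple_graph V E"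
  shows "Ind V E \<le> real (card V)"
proof -
  have "bdd_below ((\<lambda>q. Ind_q q V E) ` {2..})"
    \<comment> \<open>The empty set is independent, so all rates are at least 0; a real infimum is
      known to lie below its members only when such a bound exists.\<close>
    using independent_set_le_Ind_q[OF G, of _ "{}"] by (auto intro: bdd_belowI[of _ 0])
  then have "Ind V E \<le> Ind_q 2 V E"
    unfolding Ind_def by (rule cINF_lower) simp
  also have "\<dots> \<le> code_rate {..<2::nat} {..<2 ^ card V :: nat}"
    unfolding Ind_q_def
  proof (rule cInf_lower)
    show "bdd_below {code_rate \<Sigma> M |(\<Sigma> :: nat set) (M :: nat set).
        card \<Sigma> = 2 \<and> (\<exists>f g. index_code V E \<Sigma> M f g)}"
      using independent_set_le_code_rate[OF G, of _ _ _ _ "{}"]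
      by (force intro: bdd_belowI[of _ 0])
    have "\<exists>f g. index_code V E {..<2::nat} {..<2 ^ card V :: nat} f g"
      by (rule trivial_index_code[OF G]) simp
    moreover have "card {..<2::nat} = 2"
      by simp
    ultimately show "code_rate {..<2::nat} {..<2 ^ card V :: nat} \<in>
        {code_rate \<Sigma> M |(\<Sigma> :: nat set) (M :: nat set).
          card \<Sigma> = 2 \<and> (\<exists>f g. index_code V E \<Sigma> M f g)}"
      by blast
  qed
  finally show ?thesis
    using code_rate_trivial[of 2 "card V"] by simp
qed

lemma FCC_le_card:
  assumes G: "simple_graph V E"
  shows "FCC V E \<le> real (card V)"
proof -
  have fin: "finite V"
    using G by (simp add: simple_graph_def)
  then have fin_cl: "finite (cliques V E)"
    by (rule rev_finite_subset[OF finite_Pow_iff[THEN iffD2]]) (auto simp: cliques_def)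
  have single: "{v} \<in> cliques V E" if "v \<in> V" for v
    using that by (auto simp: cliques_def clique_def)
  define y where "y C = (if is_singleton C then 1 else 0 :: real)" for C :: "'a set"
  have "fractional_clique_cover V E y"
    unfolding fractional_clique_cover_def
  proof (intro conjI ballI)
    fix v assume v: "v \<in> V"
    have "(\<Sum>C\<in>{{v}}. y C) \<le> (\<Sum>C\<in>{C \<in> cliques V E. v \<in> C}. y C)"
      using fin_cl single[OF v] by (intro sum_mono2) (auto simp: y_def)
    then show "1 \<le> (\<Sum>C\<in>{C \<in> cliques V E. v \<in> C}. y C)"
      by (simp add: y_def)
  qed (auto simp: y_def)
  moreover have "(\<Sum>C\<in>cliques V E. y C) = real (card V)"
  proof -
    have "(\<Sum>C\<in>cliques V E. y C) = (\<Sum>C\<in>(\<lambda>v. {v}) ` V. y C)"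
      using fin_cl single
      by (intro sum.mono_neutral_right) (auto simp: y_def is_singleton_def cliques_def)
    also have "\<dots> = real (card V)"
      by (subst sum.reindex) (auto simp: y_def)
    finally show ?thesis .
  qed
  moreover have "bdd_below {\<Sum>C\<in>cliques V E. y C |y. fractional_clique_cover V E y}"
    by (auto intro!: bdd_belowI[of _ 0] sum_nonneg simp: fractional_clique_cover_def)
  ultimately show ?thesis
    unfolding FCC_def by (intro cInf_lower) (auto intro!: exI[of _ y])
qed

text \<open>A maximal independent set is dominating: the closed neighbourhoods of its members cover
  \<open>V\<close>, and each has at most \<open>D\<close> vertices.\<close>

lemma independent_set_of_bounded_degree:
  assumes G: "simple_graph V E"
    and D: "\<And>v. v \<in> V \<Longrightarrow> card (insert v (nbrs E v)) \<le> D"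
  obtains S where "S \<subseteq> V" "\<And>u v. u \<in> S \<Longrightarrow> v \<in> S \<Longrightarrow> u \<notin> nbrs E v"
    "card V \<le> D * card S"
proof -
  have fin: "finite V"
    using G by (simp add: simple_graph_def)
  define I where "I = {S. S \<subseteq> V \<and> (\<forall>u\<in>S. \<forall>v\<in>S. u \<notin> nbrs E v)}"
  have "finite I"
    using fin by (auto simp: I_def intro: finite_subset[of _ "Pow V"])
  moreover have "{} \<in> I"
    by (simp add: I_def)
  ultimately obtain S where S: "S \<in> I" and max: "\<And>T. T \<in> I \<Longrightarrow> S \<subseteq> T \<Longrightarrow> S = T"
    using finite_has_maximal[of I] by blast
  have "V \<subseteq> (\<Union>s\<in>S. insert s (nbrs E s))"
  proof
    fix v assume v: "v \<in> V"
    show "v \<in> (\<Union>s\<in>S. insert s (nbrs E s))"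
    proof (rule ccontr)
      assume "v \<notin> (\<Union>s\<in>S. insert s (nbrs E s))"
      \<comment> \<open>An undominated \<open>v\<close> could be added to \<open>S\<close>.
        Independence is required in both directions, which the symmetry
        \<open>{u, v} = {v, u}\<close> supplies.\<close>
      then have "insert v S \<in> I" "v \<notin> S"
        using S v by (auto simp: I_def nbrs_def insert_commute)
      then show False
        using max[of "insert v S"] by blast
    qed
  qed
  moreover have SV: "S \<subseteq> V"
    using S by (simp add: I_def)
  moreover have finS: "finite S"
    using SV fin by (rule finite_subset)
  ultimately have "card V \<le> card (\<Union>s\<in>S. insert s (nbrs E s))"
    using finite_subset[OF nbrs_subset[OF G] fin] by (intro card_mono) auto
  also have "\<dots> \<le> (\<Sum>s\<in>S. card (insert s (nbrs E s)))"
    by (rule card_UN_le[OF finS])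
  also have "\<dots> \<le> D * card S"
    using D SV sum_bounded_above[of S "\<lambda>s. card (insert s (nbrs E s))" D]
    by (auto simp: mult.commute)
  finally show thesis
    using that[of S] S by (auto simp: I_def)
qed

section \<open>Packing\<close>

text \<open>Area comparison. Open balls are used because they stay disjoint when two centers are at
  distance exactly \<open>l\<close>; the area of the unit disk cancels.\<close>

lemma card_separated_le:
  fixes c :: "'a \<Rightarrow> real^2"
  assumes fin: "finite A" and l: "0 < l" and r: "0 \<le> r"
    and near: "\<And>u. u \<in> A \<Longrightarrow> dist x (c u) \<le> r"
    and sep: "\<And>u v. u \<in> A \<Longrightarrow> v \<in> A \<Longrightarrow> u \<noteq> v \<Longrightarrow> l \<le> dist (c u) (c v)"
  shows "real (card A) \<le> (2 * r / l + 1)\<^sup>2"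
proof -
  let ?w = "unit_ball_vol (real DIM(real^2))"
  have disj: "disjoint_family_on (\<lambda>u. ball (c u) (l / 2)) A"
    unfolding disjoint_family_on_def
  proof (intro ballI impI)
    fix u v assume uv: "u \<in> A" "v \<in> A" "u \<noteq> v"
    show "ball (c u) (l / 2) \<inter> ball (c v) (l / 2) = {}"
      using sep[OF uv] by (intro disjoint_ballI) simp
  qed
  have "real (card A) * (?w * (l / 2)\<^sup>2) = (\<Sum>u\<in>A. measure lborel (ball (c u) (l / 2)))"
    using l by (simp add: content_ball)
  also have "\<dots> = measure lborel (\<Union>u\<in>A. ball (c u) (l / 2))"
    by (rule measure_finite_Union[symmetric])
      (use fin disj emeasure_lborel_ball_finite in \<open>auto simp: less_top\<close>)
  also have "\<dots> \<le> measure lborel (ball x (r + l / 2))"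
  proof (rule measure_mono_fmeasurable)
    show "(\<Union>u\<in>A. ball (c u) (l / 2)) \<subseteq> ball x (r + l / 2)"
    proof (intro UN_least subsetI)
      fix u z assume "u \<in> A" "z \<in> ball (c u) (l / 2)"
      then show "z \<in> ball x (r + l / 2)"
        using near[of u] dist_triangle[of x z "c u"] by simp
    qed
    show "(\<Union>u\<in>A. ball (c u) (l / 2)) \<in> sets lborel"
      using fin by (intro sets.finite_UN) auto
    show "ball x (r + l / 2) \<in> fmeasurable lborel"
      using emeasure_lborel_ball_finite by (auto intro!: fmeasurableI simp: less_top)
  qed
  also have "\<dots> = ?w * (r + l / 2)\<^sup>2"
    using l r by (simp add: content_ball)
  finally have "real (card A) * (l / 2)\<^sup>2 \<le> (r + l / 2)\<^sup>2"
    using unit_ball_vol_pos[of "real DIM(real^2)"] by (simp add: mult.left_commute)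
  then have "real (card A) \<le> (r + l / 2)\<^sup>2 / (l / 2)\<^sup>2"
    using l by (simp add: pos_le_divide_eq)
  also have "\<dots> = ((r + l / 2) / (l / 2))\<^sup>2"
    by (rule power_divide[symmetric])
  also have "(r + l / 2) / (l / 2) = 2 * r / l + 1"
    using l by (simp add: field_simps)
  finally show ?thesis .
qed

lemma precision_unit_disk_graph_degree:
  assumes l: "0 < l" and G: "precision_unit_disk_graph l V E" and v: "v \<in> V"
  shows "real (card (insert v (nbrs E v))) \<le> 64 / l\<^sup>2 + 1"
proof -
  obtain c where c: "disk_representation V E c"
    and sep: "\<And>u v. u \<in> V \<Longrightarrow> v \<in> V \<Longrightarrow> u \<noteq> v \<Longrightarrow> l \<le> dist (c u) (c v)"
    and simple: "simple_graph V E"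
    using G by (auto simp: precision_unit_disk_graph_def unit_disk_graph_def)
  have near: "dist (c v) (c u) \<le> 2" if u: "u \<in> nbrs E v" for u
  proof -
    have "u \<in> V" "u \<noteq> v" "{u, v} \<in> E"
      using u nbrs_subset[OF simple, of v] by (auto simp: nbrs_def)
    then obtain z where "z \<in> cball (c u) 1" "z \<in> cball (c v) 1"
      using c v by (force simp: disk_representation_def)
    then show ?thesis
      using dist_triangle[of "c v" "c u" z] by (simp add: dist_commute)
  qed
  have sub: "insert v (nbrs E v) \<subseteq> V"
    using v nbrs_subset[OF simple] by auto
  show ?thesis
  proof (cases "nbrs E v = {}")
    case False
    then obtain u where "u \<in> nbrs E v" by blast
    \<comment> \<open>Centers of adjacent vertices are at least \<open>l\<close> and at most 2
      apart, so a single edge forces \<open>l <= 2\<close>. A vertex without neighbours falls under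
      the other case, where the closed neighbourhood has one element.\<close>
    then have l2: "l \<le> 2"
      using near[of u] sep[of v u] v sub by (fastforce simp: nbrs_def)
    have "real (card (insert v (nbrs E v))) \<le> (2 * 2 / l + 1)\<^sup>2"
      using sub simple near sep l
      by (intro card_separated_le[of _ l 2 "c v" c]) (auto simp: simple_graph_def finite_subset)
    \<comment> \<open>Expanding the square leaves \<open>16 / l^2 + 8 / l <= 64 / l^2\<close>, that
      is \<open>l <= 6\<close>.\<close>
    also have "\<dots> \<le> 64 / l\<^sup>2 + 1"
      using l l2 by (simp add: field_simps power2_eq_square)
    finally show ?thesis .
  qed simp
qed

lemma card_le_Ind:
  assumes l: "0 < l" and G: "precision_unit_disk_graph l V E"
  shows "real (card V) \<le> (64 / l\<^sup>2 + 1) * Ind V E"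
proof -
  have simple: "simple_graph V E"
    using G by (simp add: precision_unit_disk_graph_def unit_disk_graph_def)
  \<comment> \<open>Cardinalities are integers, so rounding the real degree bound down loses
    nothing.\<close>
  define D where "D = nat \<lfloor>64 / l\<^sup>2 + 1\<rfloor>"
  have D: "real D \<le> 64 / l\<^sup>2 + 1"
    unfolding D_def by (rule of_nat_floor) simp
  have "card (insert v (nbrs E v)) \<le> D" if "v \<in> V" for v
    unfolding D_def using precision_unit_disk_graph_degree[OF l G that] by (rule le_nat_floor)
  then obtain S where S: "S \<subseteq> V" "\<And>u v. u \<in> S \<Longrightarrow> v \<in> S \<Longrightarrow> u \<notin> nbrs E v"
    and card: "card V \<le> D * card S"
    using independent_set_of_bounded_degree[OF simple] by blast
  have "real (card V) \<le> real D * real (card S)"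
    using card by (simp flip: of_nat_mult)
  also have "\<dots> \<le> (64 / l\<^sup>2 + 1) * Ind V E"
    using D independent_set_le_Ind[OF simple S] by (intro mult_mono) auto
  finally show ?thesis .
qed

section \<open>A circuit description of the trivial code\<close>

text \<open>The bits are sent in reverse order because then both the encoder and the decoders list the
  wires \<open>n - 1, \<dots>, 0\<close>, and a machine can produce either list by erasing a unary counter.\<close>

definition reversal_desc :: "nat \<Rightarrow> code_desc" where
  "reversal_desc n = \<lparr>sym_width = 1, encoder = ([], rev [0..<n]),
     decoders = map (\<lambda>j. ([], [j])) (rev [0..<n])\<rparr>"

lemma finite_bit_words: "finite (bit_words k)"
  and card_bit_words: "card (bit_words k) = 2 ^ k"
  using finite_lists_length_eq[of "UNIV :: bool set" k] card_lists_length_eq[of "UNIV :: bool set" k]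
  by (simp_all add: bit_words_def)

lemma desc_rate_reversal: "desc_rate (reversal_desc n) = real n"
  by (simp add: desc_rate_def reversal_desc_def msg_width_def code_rate_def card_bit_words
      log_nat_power)

lemma concat_map_singletons:
  "(\<And>i. i < n \<Longrightarrow> length (p i) = Suc 0) \<Longrightarrow> concat (map p [0..<n]) = map (\<lambda>i. hd (p i)) [0..<n]"
  by (induction n) (auto simp: length_Suc_conv, metis lessI list.sel(1))

lemma describes_reversal:
  assumes "simple_graph {..<n} E"
  shows "describes_index_code n E (reversal_desc n)"
proof -
  \<comment> \<open>Decoder \<open>v\<close> is entry \<open>v\<close> of the reversed list, hence
    it outputs message wire \<open>n - 1 - v\<close>, where the encoder has put bit
    \<open>v\<close>.\<close>
  have dec: "desc_decode E (reversal_desc n) v m s = [m ! (n - Suc v)]"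
    if "v < n" "length m = n" for v m s
    using that by (simp add: desc_decode_def reversal_desc_def rev_nth nth_append)
  have correct: "desc_decode E (reversal_desc n) v (desc_encode n (reversal_desc n) p) s = p v"
    if p: "p \<in> {..<n} \<rightarrow>\<^sub>E bit_words 1" and v: "v < n" for p v s
  proof -
    have len: "length (p i) = Suc 0" if "i < n" for i
      using p that by (auto simp: bit_words_def PiE_iff)
    have "desc_encode n (reversal_desc n) p = map (\<lambda>j. map (\<lambda>i. hd (p i)) [0..<n] ! j) (rev [0..<n])"
      using concat_map_singletons[of n p] len by (simp add: desc_encode_def reversal_desc_def)
    then show ?thesis
      using v len[OF v] by (simp add: dec rev_nth length_Suc_conv) fastforce
  qed
  have "index_code {..<n} E (bit_words 1) (bit_words n)
      (desc_encode n (reversal_desc n)) (desc_decode E (reversal_desc n))"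
    unfolding index_code_def
  proof (intro conjI ballI)
    show "desc_encode n (reversal_desc n) \<in> ({..<n} \<rightarrow>\<^sub>E bit_words 1) \<rightarrow> bit_words n"
      by (auto simp: desc_encode_def reversal_desc_def bit_words_def)
    show "desc_decode E (reversal_desc n) v m \<in> (nbrs E v \<rightarrow>\<^sub>E bit_words 1) \<rightarrow> bit_words 1"
      if "v \<in> {..<n}" "m \<in> bit_words n" for v m
      using that by (auto simp: dec bit_words_def)
  qed (use correct in \<open>auto simp: finite_bit_words card_bit_words\<close>)
  then show ?thesis
    unfolding describes_index_code_def
    by (auto simp: reversal_desc_def msg_width_def rev_nth)
qed

section \<open>A Turing machine printing the description\<close>

text \<open>The first three bits are symbol width 1 in unary and the empty gate list of the encoder.
  In the last block, the prefix of each item is the empty gate list of a decoder followed by its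
  output count 1. Both blocks thus have the same shape: a count, then a descending list of unary
  numbers.\<close>

lemma enc_desc_reversal:
  "enc_desc (reversal_desc n) =
     [True, False, False] @
     (enc_nat n @ concat (map (\<lambda>j. enc_nat j) (rev [0..<n]))) @
     (enc_nat n @ concat (map (\<lambda>j. [False, True, False] @ enc_nat j) (rev [0..<n])))"
  by (simp add: enc_desc_def reversal_desc_def enc_list_def comp_def)
    (simp add: enc_nat_def)

text \<open>\<open>Fill\<close> copies the vertex count to the output and the counter, and
  \<open>Rewind\<close> brings the input head back. Then each round erases a mark
  (\<open>Outer\<close>), finishes the item prefix (\<open>Pre1\<close>, \<open>Pre2\<close>,
  decoders only), prints the counter leftwards (\<open>Print\<close>) and runs back to its right end
  (\<open>Return\<close>).\<close>

datatype label = Fill | Rewind | Outer | Pre1 | Pre2 | Print | Return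

datatype state = Start1 | Start2 | Start3 | Phase bool label | Halt

fun label_code :: "label \<Rightarrow> nat" where
  "label_code Fill = 0"
| "label_code Rewind = 1"
| "label_code Outer = 2"
| "label_code Pre1 = 3"
| "label_code Pre2 = 4"
| "label_code Print = 5"
| "label_code Return = 6"

text \<open>Three start states, two blocks of seven labels at offsets 3 and 10, and 17 for
  \<open>Halt\<close>, since a machine halts in state \<open>nstates\<close>.\<close>

fun state_code :: "state \<Rightarrow> nat" where
  "state_code Start1 = 0"
| "state_code Start2 = 1"
| "state_code Start3 = 2"
| "state_code (Phase m a) = (if m then 10 else 3) + label_code a"
| "state_code Halt = 17"

lemma label_code_less: "label_code a < 7"
  by (cases a) auto

lemma label_code_eq_iff: "label_code a = label_code b \<longleftrightarrow> a = b"
  by (cases a; cases b) auto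

lemma state_code_less: "s \<noteq> Halt \<Longrightarrow> state_code s < 17"
proof (cases s)
  case (Phase m a)
  then show ?thesis
    using label_code_less[of a] by simp
qed auto

lemma state_code_le: "state_code s \<le> 17"
  using state_code_less[of s] by (cases "s = Halt") auto

lemma inj_state_code: "inj state_code"
proof (rule injI)
  fix s s' assume eq: "state_code s = state_code s'"
  have phase: "s = s'" if "s = Phase m a" "state_code s = state_code s'" for s s' m a
  proof (cases s')
    case (Phase m' b)
    then show ?thesis
      using that label_code_less[of a] label_code_less[of b]
      by (cases m; cases m') (auto simp: label_code_eq_iff)
  qed (use that label_code_less[of a] in \<open>auto split: if_splits\<close>)
  show "s = s'"
  proof (cases "\<exists>m a. s = Phase m a \<or> s' = Phase m a")
    case True
    then show ?thesis
      using phase eq by metis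
  next
    case False
    then show ?thesis
      using eq by (cases s; cases s') auto
  qed
qed

text \<open>The arguments are the state and the symbols read on the input tape and on a third tape used
  as unary counter; the results are the next state, the move on the input tape, the bits appended
  to the output, and the action on the counter. The two phases, for the encoder and for the
  decoders, both print the vertex count and then count down, and differ only in the prefix of each
  item.\<close>

fun trans_fun :: "state \<Rightarrow> sym \<Rightarrow> sym \<Rightarrow> state \<times> move \<times> bool list \<times> sym \<times> move" where
  "trans_fun Start1 a w = (Start2, Stay, [True], w, Stay)"
| "trans_fun Start2 a w = (Start3, Stay, [False], w, Stay)"
| "trans_fun Start3 a w = (Phase False Fill, Stay, [False], w, Stay)"
| "trans_fun (Phase m Fill) a w =
     (if a = Bit True then (Phase m Fill, MoveR, [True], Bit True, MoveR)
      else (Phase m Rewind, MoveL, [False], w, MoveL))"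
| "trans_fun (Phase m Rewind) a w =
     (if a = Bit True then (Phase m Rewind, MoveL, [], w, Stay)
      else (Phase m Outer, MoveR, [], w, Stay))"
| "trans_fun (Phase m Outer) a w =
     (if w = Bit True
      then (if m then (Phase m Pre1, Stay, [False], Blank, MoveL)
            else (Phase m Print, Stay, [], Blank, MoveL))
      else (if m then Halt else Phase True Fill, Stay, [], w, MoveR))"
| "trans_fun (Phase m Pre1) a w = (Phase m Pre2, Stay, [True], w, Stay)"
| "trans_fun (Phase m Pre2) a w = (Phase m Print, Stay, [False], w, Stay)"
| "trans_fun (Phase m Print) a w =
     (if w = Bit True then (Phase m Print, Stay, [True], w, MoveL)
      else (Phase m Return, Stay, [False], w, MoveR))"
| "trans_fun (Phase m Return) a w =
     (if w = Bit True then (Phase m Return, Stay, [], w, MoveR)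
      else (Phase m Outer, Stay, [], w, MoveL))"
| "trans_fun Halt a w = (Halt, Stay, [], w, Stay)"

definition printer :: tm where
  "printer = \<lparr>ntapes = 3, nstates = 17,
     delta = \<lambda>q ss. case trans_fun (inv state_code q) (ss ! 0) (ss ! 2) of
       (s, d, bs, w, e) \<Rightarrow>
         (state_code s,
          [(ss ! 0, d), (case bs of [] \<Rightarrow> (ss ! 1, Stay) | b # _ \<Rightarrow> (Bit b, MoveR)), (w, e)])\<rparr>"

lemma wf_printer: "wf_tm printer"
  by (auto simp: wf_tm_def printer_def state_code_le split: prod.split)

section \<open>Configurations, single steps and bounded runs of the machine\<close>

definition unary_tape :: "nat \<Rightarrow> int \<Rightarrow> sym" where
  "unary_tape k j = (if 0 \<le> j \<and> j < int k then Bit True else Blank)"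

text \<open>The output is append-only, so its head always stands just behind the word and needs no
  parameter of its own.\<close>

definition conf :: "state \<Rightarrow> bool list \<Rightarrow> int \<Rightarrow> bool list \<Rightarrow> (int \<Rightarrow> sym) \<Rightarrow> int \<Rightarrow> nat \<times> tape list" where
  "conf s x i y w j = (state_code s,
     [(word_on_tape x, i), (word_on_tape y, int (length y)), (w, j)])"

lemma word_on_tape_snoc: "(word_on_tape y)(int (length y) := Bit b) = word_on_tape (y @ [b])"
  by (auto simp: word_on_tape_def fun_eq_iff nth_append)

lemma length_trans_fun: "trans_fun s a b = (s', d, bs, c, e) \<Longrightarrow> length bs \<le> 1"
  by (induction s a b rule: trans_fun.induct) (auto split: if_splits)

lemma printer_step:
  assumes "s \<noteq> Halt"
  shows "tm_step printer (conf s x i y w j) =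
    (case trans_fun s (word_on_tape x i) (w j) of (s', d, bs, b, e) \<Rightarrow>
       conf s' x (i + shift d) (y @ bs) (w(j := b)) (j + shift e))"
proof -
  obtain s' d bs b e where t: "trans_fun s (word_on_tape x i) (w j) = (s', d, bs, b, e)"
    by (metis prod_cases5)
  show ?thesis
    using state_code_less[OF assms] t length_trans_fun[OF t]
    by (cases bs) (auto simp: conf_def printer_def inv_f_f[OF inj_state_code] word_on_tape_snoc)
qed

text \<open>The step count is only bounded, so that estimates may be rounded up and both phases can
  share one bound.\<close>

definition reaches :: "nat \<Rightarrow> nat \<times> tape list \<Rightarrow> nat \<times> tape list \<Rightarrow> bool" where
  "reaches t c c' \<longleftrightarrow> (\<exists>s\<le>t. (tm_step printer ^^ s) c = c')"

lemma reaches_refl: "reaches t c c"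
  by (auto simp: reaches_def intro: exI[of _ 0])

lemma reaches_trans:
  assumes "reaches t c c'" "reaches t' c' c''" "t + t' \<le> u"
  shows "reaches u c c''"
proof -
  obtain s s' where "s \<le> t" "s' \<le> t'" "(tm_step printer ^^ s) c = c'"
    "(tm_step printer ^^ s') c' = c''"
    using assms by (auto simp: reaches_def)
  then show ?thesis
    using assms(3) unfolding reaches_def by (intro exI[of _ "s' + s"]) (simp add: funpow_add)
qed

text \<open>Symbolic execution: \<open>simp\<close> evaluates one transition and leaves the run from
  the resulting configuration.\<close>

lemma reaches_step:
  assumes "s \<noteq> Halt"
    and "reaches t (case trans_fun s (word_on_tape x i) (w j) of (s', d, bs, b, e) \<Rightarrow>
           conf s' x (i + shift d) (y @ bs) (w(j := b)) (j + shift e)) c"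
  shows "reaches (Suc t) (conf s x i y w j) c"
proof -
  have "reaches 1 (conf s x i y w j) (tm_step printer (conf s x i y w j))"
    unfolding reaches_def by (intro exI[of _ 1]) simp
  then show ?thesis
    using assms(2) unfolding printer_step[OF assms(1)] by (rule reaches_trans) simp
qed

section \<open>Effect and running time of the inner loops\<close>

lemma word_on_tape_enc_nat:
  "0 \<le> i \<Longrightarrow> i < int n \<Longrightarrow> word_on_tape (enc_nat n @ z) i = Bit True"
  "word_on_tape (enc_nat n @ z) (int n) = Bit False"
  "word_on_tape (enc_nat n @ z) (- 1) = Blank"
  by (auto simp: word_on_tape_def enc_nat_def nth_append nat_less_iff)

lemma unary_tape_upd:
  "(unary_tape k)(int k := Bit True) = unary_tape (Suc k)"
  "(unary_tape (Suc k))(int k := Blank) = unary_tape k"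
  by (auto simp: unary_tape_def fun_eq_iff)

lemma unary_tape_idem:
  "0 \<le> j \<Longrightarrow> j < int k \<Longrightarrow> (unary_tape k)(j := Bit True) = unary_tape k"
  "j < 0 \<or> int k \<le> j \<Longrightarrow> (unary_tape k)(j := Blank) = unary_tape k"
  by (auto simp: unary_tape_def fun_eq_iff)

lemma enc_nat_Suc: "enc_nat (Suc i) = True # enc_nat i"
  and enc_nat_0: "enc_nat 0 = [False]"
  by (simp_all add: enc_nat_def)

text \<open>Here \<open>k\<close> marks are copied and \<open>i\<close> remain. The
  \<open>False\<close> at cell \<open>n\<close> of the input stops the loop; that last step prints
  the delimiter and moves both heads left to cell \<open>n - 1\<close>.\<close>

lemma reaches_fill:
  assumes "x = enc_nat n @ z" and "k + i = n"
  shows "reaches (Suc i) (conf (Phase m Fill) x (int k) y (unary_tape k) (int k))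
           (conf (Phase m Rewind) x (int n - 1) (y @ enc_nat i) (unary_tape n) (int n - 1))"
  using assms(2)
proof (induction i arbitrary: k y)
  case 0
  then show ?case
    by (intro reaches_step) (simp_all add: assms(1) word_on_tape_enc_nat enc_nat_0 reaches_refl)
next
  case (Suc i)
  then show ?case
    using Suc.IH[of "Suc k" "y @ [True]"]
    by (intro reaches_step)
      (simp_all add: assms(1) word_on_tape_enc_nat enc_nat_Suc unary_tape_upd add.commute)
qed

text \<open>The head walks over \<open>i\<close> ones to the blank cell \<open>-1\<close>, and one
  more step puts it on cell 0.\<close>

lemma reaches_rewind:
  assumes "x = enc_nat n @ z" and "i \<le> n"
  shows "reaches (Suc i) (conf (Phase m Rewind) x (int i - 1) y w j)
           (conf (Phase m Outer) x 0 y w j)"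
  using assms(2)
proof (induction i)
  case 0
  then show ?case
    by (intro reaches_step) (simp_all add: assms(1) word_on_tape_enc_nat reaches_refl)
next
  case (Suc i)
  then show ?case
    by (intro reaches_step) (simp_all add: assms(1) word_on_tape_enc_nat)
qed

text \<open>The marks at cells \<open>i - 1\<close> down to 0 are printed as ones, and the blank at
  \<open>-1\<close> yields the delimiter. Only \<open>i = k\<close> is used later; smaller
  \<open>i\<close> serve the induction.\<close>

lemma reaches_print:
  assumes "i \<le> k"
  shows "reaches (Suc i) (conf (Phase m Print) x h y (unary_tape k) (int i - 1))
           (conf (Phase m Return) x h (y @ enc_nat i) (unary_tape k) 0)"
  using assms
proof (induction i arbitrary: y)
  case 0
  have "unary_tape k (- 1) = Blank"
    by (simp add: unary_tape_def)
  then show ?case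
    by (intro reaches_step) (simp_all add: enc_nat_0 unary_tape_idem reaches_refl)
next
  case (Suc i)
  then have "unary_tape k (int i) = Bit True"
    by (simp add: unary_tape_def)
  then show ?case
    using Suc.prems Suc.IH[of "y @ [True]"]
    by (intro reaches_step) (simp_all add: enc_nat_Suc unary_tape_idem)
qed

text \<open>Here \<open>i\<close> is the distance to the first blank, at cell \<open>k\<close>; the
  last step goes back onto the final mark, or to \<open>-1\<close> if the counter is empty.\<close>

lemma reaches_return:
  assumes "i \<le> k"
  shows "reaches (Suc i) (conf (Phase m Return) x h y (unary_tape k) (int k - int i))
           (conf (Phase m Outer) x h y (unary_tape k) (int k - 1))"
  using assms
proof (induction i)
  case 0
  have "unary_tape k (int k) = Blank"
    by (simp add: unary_tape_def)
  then show ?case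
    by (intro reaches_step) (simp_all add: unary_tape_idem reaches_refl)
next
  case (Suc i)
  then have "unary_tape k (int k - (1 + int i)) = Bit True"
    by (simp add: unary_tape_def)
  moreover have "int k - (1 + int i) + 1 = int k - int i"
    by simp
  ultimately show ?case
    using Suc by (intro reaches_step) (simp_all add: unary_tape_idem)
qed

section \<open>The countdown, complete phases and the total running time\<close>

definition item_prefix :: "bool \<Rightarrow> bool list" where
  "item_prefix m = (if m then [False, True, False] else [])"

definition next_state :: "bool \<Rightarrow> state" where
  "next_state m = (if m then Halt else Phase True Fill)"

text \<open>The mark is erased before printing, so a counter holding \<open>v + 1\<close> yields
  item \<open>v\<close>, and the list runs from \<open>n - 1\<close> down to 0. The 3 counts
  \<open>Outer\<close>, \<open>Pre1\<close> and \<open>Pre2\<close>; without a prefix one step is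
  enough.\<close>

lemma reaches_item:
  "reaches (3 + Suc v) (conf (Phase m Outer) x h y (unary_tape (Suc v)) (int v))
     (conf (Phase m Return) x h (y @ item_prefix m @ enc_nat v) (unary_tape v) 0)"
proof -
  have read: "unary_tape (Suc v) (int v) = Bit True"
    by (simp add: unary_tape_def)
  have "reaches 3 (conf (Phase m Outer) x h y (unary_tape (Suc v)) (int v))
      (conf (Phase m Print) x h (y @ item_prefix m) (unary_tape v) (int v - 1))"
  proof (cases m)
    case True
    then show ?thesis
      unfolding numeral_3_eq_3
      by (intro reaches_step; simp add: read unary_tape_upd item_prefix_def)
        (intro reaches_step; simp add: read reaches_refl)+
  next
    case False
    then show ?thesis
      unfolding numeral_3_eq_3
      by (intro reaches_step) (simp_all add: read unary_tape_upd item_prefix_def reaches_refl)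
  qed
  from reaches_trans[OF this reaches_print[OF order.refl] order.refl] show ?thesis
    by simp
qed

text \<open>A round starting with \<open>w <= v\<close> marks takes at most
  \<open>3 + 2 * w <= 2 * v + 3\<close> steps, and there are \<open>v\<close> rounds. The final step
  finds the counter empty and moves its head from \<open>-1\<close> to 0, ready for the next
  phase.\<close>

lemma reaches_countdown:
  "reaches ((2 * v + 3) * v + 1) (conf (Phase m Outer) x h y (unary_tape v) (int v - 1))
     (conf (next_state m) x h
        (y @ concat (map (\<lambda>j. item_prefix m @ enc_nat j) (rev [0..<v]))) (unary_tape 0) 0)"
proof (induction v arbitrary: y)
  case 0
  have "unary_tape 0 (- 1) = Blank"
    by (simp add: unary_tape_def)
  then have "reaches (Suc 0) (conf (Phase m Outer) x h y (unary_tape 0) (- 1))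
      (conf (next_state m) x h y (unary_tape 0) 0)"
    by (intro reaches_step) (simp_all add: unary_tape_idem next_state_def reaches_refl)
  then show ?case by simp
next
  case (Suc v)
  have "reaches (Suc v) (conf (Phase m Return) x h y' (unary_tape v) 0)
      (conf (Phase m Outer) x h y' (unary_tape v) (int v - 1))" for y'
    using reaches_return[of v v] by simp
  from reaches_trans[OF reaches_item this order.refl]
  have "reaches (3 + Suc v + Suc v) (conf (Phase m Outer) x h y (unary_tape (Suc v)) (int v))
      (conf (Phase m Outer) x h (y @ item_prefix m @ enc_nat v) (unary_tape v) (int v - 1))" .
  from reaches_trans[OF this Suc.IH, of "(2 * Suc v + 3) * Suc v + 1"]
  show ?case
    by (simp add: algebra_simps)
qed

text \<open>Filling and rewinding take \<open>n + 1\<close> steps each, and the countdown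
  \<open>(2 * n + 3) * n + 1\<close>.\<close>

lemma reaches_phase:
  assumes "x = enc_nat n @ z"
  shows "reaches (2 * n\<^sup>2 + 5 * n + 3) (conf (Phase m Fill) x 0 y (unary_tape 0) 0)
           (conf (next_state m) x 0
              (y @ enc_nat n @ concat (map (\<lambda>j. item_prefix m @ enc_nat j) (rev [0..<n])))
              (unary_tape 0) 0)"
proof -
  have "reaches (Suc n) (conf (Phase m Fill) x 0 y (unary_tape 0) 0)
      (conf (Phase m Rewind) x (int n - 1) (y @ enc_nat n) (unary_tape n) (int n - 1))"
    using reaches_fill[OF assms, of 0 n m y] by simp
  from reaches_trans[OF reaches_trans[OF this reaches_rewind[OF assms order.refl] order.refl]
      reaches_countdown, of "2 * n\<^sup>2 + 5 * n + 3"]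
  show ?thesis
    by (simp add: power2_eq_square algebra_simps)
qed

lemma reaches_output:
  assumes "x = enc_nat n @ z"
  shows "reaches (4 * n\<^sup>2 + 10 * n + 9) (conf Start1 x 0 [] (unary_tape 0) 0)
           (conf Halt x 0 (enc_desc (reversal_desc n)) (unary_tape 0) 0)"
proof -
  have "reaches 3 (conf Start1 x 0 [] (unary_tape 0) 0)
      (conf (Phase False Fill) x 0 [True, False, False] (unary_tape 0) 0)"
    unfolding numeral_3_eq_3
    by (intro reaches_step; simp) (intro reaches_step; simp add: reaches_refl)+
  from reaches_trans[OF this reaches_phase[OF assms] order.refl]
  have "reaches (3 + (2 * n\<^sup>2 + 5 * n + 3)) (conf Start1 x 0 [] (unary_tape 0) 0)
      (conf (Phase True Fill) x 0 ([True, False, False] @ enc_nat n @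
         concat (map enc_nat (rev [0..<n]))) (unary_tape 0) 0)"
    by (simp add: next_state_def item_prefix_def)
  from reaches_trans[OF this reaches_phase[OF assms], of "4 * n\<^sup>2 + 10 * n + 9"]
  show ?thesis
    by (simp add: enc_desc_reversal next_state_def item_prefix_def)
qed

lemma printer_outputs:
  "\<exists>t \<le> 4 * n\<^sup>2 + 10 * n + 9. tm_outputs printer (enc_graph n E) (enc_desc (reversal_desc n)) t"
proof -
  obtain z where x: "enc_graph n E = enc_nat n @ z"
    by (simp add: enc_graph_def)
  obtain t where t: "t \<le> 4 * n\<^sup>2 + 10 * n + 9"
    "(tm_step printer ^^ t) (conf Start1 (enc_graph n E) 0 [] (unary_tape 0) 0) =
       conf Halt (enc_graph n E) 0 (enc_desc (reversal_desc n)) (unary_tape 0) 0"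
    using reaches_output[OF x] by (auto simp: reaches_def)
  \<comment> \<open>A blank tape is both the empty output word and the empty counter.\<close>
  have "word_on_tape [] = unary_tape 0"
    by (auto simp: word_on_tape_def unary_tape_def fun_eq_iff)
  then have "tm_init printer (enc_graph n E) = conf Start1 (enc_graph n E) 0 [] (unary_tape 0) 0"
    by (simp add: tm_init_def conf_def printer_def numeral_2_eq_2)
  then have "tm_outputs printer (enc_graph n E) (enc_desc (reversal_desc n)) t"
    using t(2) by (simp add: tm_outputs_def conf_def) (simp add: printer_def)
  then show ?thesis
    using t(1) by blast
qed

theorem theorem7:
  fixes l :: real
  assumes "0 < l"
  shows "(\<forall>(V :: 'v set) E. precision_unit_disk_graph l V E \<longrightarrow>
            FCC V E / Ind V E \<le> 64 / l\<^sup>2 + 1) \<and>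
         Ind_poly_time_approximable (precision_unit_disk_graph l) (64 / l\<^sup>2 + 1)"
proof (intro conjI allI impI)
  fix V :: "'v set" and E
  assume G: "precision_unit_disk_graph l V E"
  then have simple: "simple_graph V E"
    by (simp add: precision_unit_disk_graph_def unit_disk_graph_def)
  then have "0 < real (card V)"
    by (simp add: simple_graph_def card_gt_0_iff)
  also note card_le_Ind[OF assms G]
  \<comment> \<open>Since \<open>V\<close> is nonempty, \<open>n <= c * Ind\<close> forces
    \<open>Ind\<close> to be positive, which allows multiplying out the quotient.\<close>
  finally have "0 < (64 / l\<^sup>2 + 1) * Ind V E" .
  moreover have "0 \<le> 64 / l\<^sup>2 + 1"
    by simp
  ultimately have "0 < Ind V E"
    by (auto simp only: zero_less_mult_iff not_less[symmetric])
  then show "FCC V E / Ind V E \<le> 64 / l\<^sup>2 + 1"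
    using FCC_le_card[OF simple] card_le_Ind[OF assms G] by (simp add: pos_divide_le_eq)
next
  let ?P = "precision_unit_disk_graph l :: nat set \<Rightarrow> nat set set \<Rightarrow> bool"
  show "Ind_poly_time_approximable ?P (64 / l\<^sup>2 + 1)"
    unfolding Ind_poly_time_approximable_def
  \<comment> \<open>The polynomial is the time bound \<open>4 * n^2 + 10 * n + 9\<close>, constant
    coefficient first.\<close>
  proof (intro exI[of _ printer] exI[of _ "[:9, 10, 4:]"] conjI wf_printer allI impI)
    fix n E assume G: "?P {..<n} E"
    then have simple: "simple_graph {..<n} E"
      by (simp add: precision_unit_disk_graph_def unit_disk_graph_def)
    obtain t where t: "t \<le> 4 * n\<^sup>2 + 10 * n + 9"
      "tm_outputs printer (enc_graph n E) (enc_desc (reversal_desc n)) t"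
      using printer_outputs by blast
    have "4 * n\<^sup>2 + 10 * n + 9 \<le> poly [:9, 10, 4:] (n + card E)"
      by (simp add: power2_eq_square algebra_simps)
    then show "\<exists>d t. t \<le> poly [:9, 10, 4:] (n + card E) \<and>
        tm_outputs printer (enc_graph n E) (enc_desc d) t \<and> describes_index_code n E d \<and>
        Ind {..<n} E \<le> desc_rate d \<and> desc_rate d \<le> (64 / l\<^sup>2 + 1) * Ind {..<n} E"
      using t describes_reversal[OF simple] Ind_le_card[OF simple] card_le_Ind[OF assms G]
      by (intro exI[of _ "reversal_desc n"] exI[of _ t])
        (simp add: desc_rate_reversal)
  qed
qed

end
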